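(* Let $n\ge1$, $M\ge2$ be integers and let $K_1,\dots,K_M$ be nonempty convex sets in $\mathbb{R}^n$. Then for any collection $\mathcal{G}$ of subsets of $[M]=\{1,\dots,M\}$ and any fractional partition $\beta$ using $\mathcal{G}$, $$|K_1+\dots+K_M|^{1/n}\ge\sum_{s\in\mathcal{G}}\beta_s\Big|\sum_{j\in s}K_j\Big|^{1/n}.$$ If the sets $K_j$ are homothetic, one has equality.
   Context: A fractional partition using a collection $\mathcal{G}$ of subsets of $[M]$ is a function $\beta:\mathcal{G}\to[0,1]$, $s\mapsto\beta_s$, with $\sum_{s\in\mathcal{G}:\,i\in s}\beta_s=1$ for each $i\in[M]$. $|K|$ denotes Lebesgue measure of $K\subset\mathbb{R}^n$, and $+$ between sets denotes the Minkowski sum (an empty Minkowski sum is $\{0\}$; $0\cdot\infty=0$). Sets are homothetic if they are equal up to translation and (positive) dilatation. *)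

theory Defs
  imports "HOL-Analysis.Analysis"
begin

definition fractional_partition :: "nat \<Rightarrow> nat set set \<Rightarrow> (nat set \<Rightarrow> real) \<Rightarrow> bool" where
  "fractional_partition M G \<beta> \<longleftrightarrow>
     (\<forall>s\<in>G. 0 \<le> \<beta> s \<and> \<beta> s \<le> 1) \<and>
     (\<forall>i\<in>{1..M}. (\<Sum>s\<in>{s \<in> G. i \<in> s}. \<beta> s) = 1)"

text \<open>
  The sets are not assumed bounded, so volumes may be infinite. We work in \<^typ>\<open>ennreal\<close>, where
  \<^prop>\<open>(0::ennreal) * \<infinity> = 0\<close>, and extend the \<open>n\<close>-th root (for \<open>n \<ge> 1\<close>)
  by \<open>\<infinity>\<close> at \<open>\<infinity>\<close>.
\<close>

definition ennreal_root :: "nat \<Rightarrow> ennreal \<Rightarrow> ennreal" where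
  "ennreal_root n x = (if x = \<infinity> then \<infinity> else ennreal (root n (enn2real x)))"

definition homothetic :: "'a::real_vector set \<Rightarrow> 'a set \<Rightarrow> bool" where
  "homothetic A B \<longleftrightarrow> (\<exists>c>0. \<exists>a. B = (\<lambda>x. a + c *\<^sub>R x) ` A)"

text \<open>
  Addition on sets is that of \<^theory>\<open>HOL-Library.Set_Algebras\<close>, so for finite \<open>s\<close> the term
  \<open>\<Sum>j\<in>s. K j\<close> denotes the Minkowski sum of the sets \<open>K j\<close>, which is
  \<open>0 = {0}\<close> when \<open>s\<close> is empty. Volume is taken with respect to \<^const>\<open>lebesgue\<close> (the completed
  measure), since convex sets need not be Borel.
\<close>

end

theory Submission
  imports Defs
begin

text \<open>
  By the Brunn-Minkowski inequality and homogeneity,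
  \<open>\<Sum>\<^sub>s \<beta>\<^sub>s |\<Sum>\<^bsub>j\<in>s\<^esub> K\<^sub>j|\<^bsup>1/n\<^esup> \<le> |\<Sum>\<^sub>s \<beta>\<^sub>s \<Sum>\<^bsub>j\<in>s\<^esub> K\<^sub>j|\<^bsup>1/n\<^esup>\<close>, and the set on the right is contained in
  \<open>\<Sum>\<^sub>j K\<^sub>j\<close>: after exchanging the sums, the \<open>j\<close>-th term is a convex combination of points of \<open>K\<^sub>j\<close>,
  because \<open>\<Sum>\<^bsub>s\<ni>j\<^esub> \<beta>\<^sub>s = 1\<close>. The Brunn-Minkowski inequality is proved by the method of Hadwiger and Ohmann:
  for finite disjoint unions of boxes by induction on the number of boxes, starting from the
  inequality of arithmetic and geometric means, and for open sets by approximation from inside.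
\<close>

subsection \<open>Disjoint unions of boxes\<close>

text \<open>For the inclusion from right to left, each coordinate of \<open>x\<close> divides the
  corresponding side of the large box in a ratio \<open>l i\<close>. The points that divide the
  sides of the two small boxes in these same ratios lie in those boxes and add up to
  \<open>x\<close>.\<close>

lemma box_set_plus:
  fixes a b c d :: "'a::euclidean_space"
  assumes "box a b \<noteq> {}" "box c d \<noteq> {}"
  shows "box a b + box c d = box (a + c) (b + d)"
proof
  show "box a b + box c d \<subseteq> box (a + c) (b + d)"
    by (force simp: set_plus_def mem_box inner_add_left intro: add_strict_mono)
  show "box (a + c) (b + d) \<subseteq> box a b + box c d"
  proof
    fix x assume x: "x \<in> box (a + c) (b + d)"
    have ab: "a \<bullet> i < b \<bullet> i" and cd: "c \<bullet> i < d \<bullet> i" if "i \<in> Basis" for i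
      using assms that by (auto simp: box_ne_empty)
    define l where "l i = (x - a - c) \<bullet> i / ((b - a) \<bullet> i + (d - c) \<bullet> i)" for i
    define y where "y = (\<Sum>i\<in>Basis. (a \<bullet> i + l i * ((b - a) \<bullet> i)) *\<^sub>R i)"
    have y: "y \<bullet> i = a \<bullet> i + l i * ((b - a) \<bullet> i)" if "i \<in> Basis" for i
      using that by (simp add: y_def inner_sum_left inner_Basis if_distrib cong: if_cong)
    have l: "0 < l i" "l i < 1" "l i * ((b - a) \<bullet> i) + l i * ((d - c) \<bullet> i) = (x - a - c) \<bullet> i"
      if "i \<in> Basis" for i
    proof -
      have *: "0 < (b - a) \<bullet> i + (d - c) \<bullet> i"
        using ab[OF that] cd[OF that] by (simp add: inner_diff_left)
      show "0 < l i" "l i < 1"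
        using x that * unfolding l_def by (auto simp: mem_box inner_simps)
      show "l i * ((b - a) \<bullet> i) + l i * ((d - c) \<bullet> i) = (x - a - c) \<bullet> i"
        using * unfolding l_def distrib_left[symmetric] by simp
    qed
    have "y \<in> box a b"
    proof (clarsimp simp: mem_box)
      fix i :: 'a assume i: "i \<in> Basis"
      have "0 < l i * ((b - a) \<bullet> i)" "l i * ((b - a) \<bullet> i) < 1 * ((b - a) \<bullet> i)"
        using l[OF i] ab[OF i] by (auto simp: inner_diff_left intro!: mult_pos_pos mult_strict_right_mono)
      then show "a \<bullet> i < y \<bullet> i \<and> y \<bullet> i < b \<bullet> i"
        by (simp add: y[OF i] inner_diff_left)
    qed
    moreover have "x - y \<in> box c d"
    proof (clarsimp simp: mem_box)
      fix i :: 'a assume i: "i \<in> Basis"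
      have "0 < l i * ((d - c) \<bullet> i)" "l i * ((d - c) \<bullet> i) < 1 * ((d - c) \<bullet> i)"
        using l[OF i] cd[OF i] by (auto simp: inner_diff_left intro!: mult_pos_pos mult_strict_right_mono)
      then show "c \<bullet> i < (x - y) \<bullet> i \<and> (x - y) \<bullet> i < d \<bullet> i"
        using l(3)[OF i] by (simp add: y[OF i] inner_diff_left)
    qed
    ultimately show "x \<in> box a b + box c d"
      by (metis add_diff_cancel_left' diff_add_cancel add.commute set_plus_intro)
  qed
qed

text \<open>The new corner is \<open>b\<close> with its \<open>i\<close>-th coordinate lowered to
  \<open>min (b \<bullet> i) t\<close>. If the halfspace misses the box, this corner spans an empty
  box with \<open>a\<close>, so one formula serves for every \<open>t\<close>.\<close>

lemma box_Int_lower_halfspace: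
  fixes a b i :: "'a::euclidean_space"
  assumes "i \<in> Basis"
  shows "box a b \<inter> {x. x \<bullet> i < t} = box a (b + (min (b \<bullet> i) t - b \<bullet> i) *\<^sub>R i)"
proof -
  have *: "(b + (min (b \<bullet> i) t - b \<bullet> i) *\<^sub>R i) \<bullet> j = (if j = i then min (b \<bullet> i) t else b \<bullet> j)"
    if "j \<in> Basis" for j
    using that assms by (simp add: inner_add_left inner_Basis)
  have e: "x \<in> box a (b + (min (b \<bullet> i) t - b \<bullet> i) *\<^sub>R i) \<longleftrightarrow>
      (\<forall>j\<in>Basis. a \<bullet> j < x \<bullet> j \<and> x \<bullet> j < b \<bullet> j \<and> (j = i \<longrightarrow> x \<bullet> j < t))" for x
    unfolding mem_box by (intro ball_cong refl) (auto simp: *)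
  show ?thesis
    unfolding set_eq_iff Int_iff e using assms by (auto simp: mem_box)
qed

lemma box_Int_upper_halfspace:
  fixes a b i :: "'a::euclidean_space"
  assumes "i \<in> Basis"
  shows "box a b \<inter> {x. t < x \<bullet> i} = box (a + (max (a \<bullet> i) t - a \<bullet> i) *\<^sub>R i) b"
proof -
  have *: "(a + (max (a \<bullet> i) t - a \<bullet> i) *\<^sub>R i) \<bullet> j = (if j = i then max (a \<bullet> i) t else a \<bullet> j)"
    if "j \<in> Basis" for j
    using that assms by (simp add: inner_add_left inner_Basis)
  have e: "x \<in> box (a + (max (a \<bullet> i) t - a \<bullet> i) *\<^sub>R i) b \<longleftrightarrow>
      (\<forall>j\<in>Basis. a \<bullet> j < x \<bullet> j \<and> x \<bullet> j < b \<bullet> j \<and> (j = i \<longrightarrow> t < x \<bullet> j))" for x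
    unfolding mem_box by (intro ball_cong refl) (auto simp: *)
  show ?thesis
    unfolding set_eq_iff Int_iff e using assms by (auto simp: mem_box)
qed

section \<open>Volume of boxes and the Brunn-Minkowski inequality for two boxes\<close>

lemma measure_lebesgue_box:
  fixes a b :: "'a::euclidean_space"
  assumes "box a b \<noteq> {}"
  shows "measure lebesgue (box a b) = (\<Prod>i\<in>Basis. (b - a) \<bullet> i)" and "0 < measure lebesgue (box a b)"
proof -
  have ab: "a \<bullet> i < b \<bullet> i" if "i \<in> Basis" for i
    using assms that by (auto simp: box_ne_empty)
  show *: "measure lebesgue (box a b) = (\<Prod>i\<in>Basis. (b - a) \<bullet> i)"
    by (simp add: measure_completion measure_lborel_box_eq ab less_imp_le)
  show "0 < measure lebesgue (box a b)"
    unfolding * by (intro prod_pos) (simp add: ab inner_diff_left)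
qed

text \<open>Superadditivity of the geometric mean. After division by the geometric mean of
  \<open>f + g\<close>, the inequality of arithmetic and geometric means bounds the two terms by the
  arithmetic means of \<open>f i / (f i + g i)\<close> and \<open>g i / (f i + g i)\<close>, which
  add up to 1.\<close>

lemma root_prod_add_le:
  fixes f g :: "'a \<Rightarrow> real"
  assumes "finite S" "S \<noteq> {}" and f: "\<And>i. i \<in> S \<Longrightarrow> 0 < f i" and g: "\<And>i. i \<in> S \<Longrightarrow> 0 < g i"
  shows "root (card S) (prod f S) + root (card S) (prod g S) \<le> root (card S) (\<Prod>i\<in>S. f i + g i)"
proof -
  let ?n = "card S"
  have n: "?n > 0" using assms by (simp add: card_gt_0_iff)
  let ?h = "\<lambda>i. f i + g i"
  have h: "0 < ?h i" if "i \<in> S" for i using f g that by (simp add: add_pos_pos)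
  have amgm: "root ?n (prod u S) \<le> root ?n (prod ?h S) * (\<Sum>i\<in>S. u i / ?h i / ?n)"
    if u: "\<And>i. i \<in> S \<Longrightarrow> 0 < u i" for u
  proof -
    have "root ?n (\<Prod>i\<in>S. u i / ?h i) \<le> (\<Sum>i\<in>S. u i / ?h i / ?n)"
      using arith_geom_mean[OF assms(1,2), of "\<lambda>i. u i / ?h i"] u h n
      by (simp add: root_powr_inverse prod_pos less_imp_le prod_nonneg)
    moreover have "prod u S = prod ?h S * (\<Prod>i\<in>S. u i / ?h i)"
      unfolding prod.distrib[symmetric] by (intro prod.cong refl) (use h in force)
    moreover have "0 \<le> root ?n (prod ?h S)"
      by (intro real_root_ge_zero prod_nonneg ballI less_imp_le h)
    ultimately show ?thesis
      by (simp add: real_root_mult mult_left_mono)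
  qed
  have "(\<Sum>i\<in>S. f i / ?h i / ?n) + (\<Sum>i\<in>S. g i / ?h i / ?n) = (\<Sum>i\<in>S. 1 / ?n)"
    unfolding sum.distrib[symmetric]
    by (intro sum.cong refl) (use h in \<open>force simp flip: add_divide_distrib\<close>)
  also have "\<dots> = 1" using n by simp
  finally have "root ?n (prod ?h S) * (\<Sum>i\<in>S. f i / ?h i / ?n) + root ?n (prod ?h S) * (\<Sum>i\<in>S. g i / ?h i / ?n)
     = root ?n (prod ?h S)"
    by (simp flip: distrib_left)
  with amgm[of f, OF f] amgm[of g, OF g] show ?thesis by linarith
qed

lemma Brunn_Minkowski_box:
  fixes a b c d :: "'a::euclidean_space"
  assumes ab: "box a b \<noteq> {}" and cd: "box c d \<noteq> {}"
  shows "root DIM('a) (measure lebesgue (box a b)) + root DIM('a) (measure lebesgue (box c d))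
          \<le> root DIM('a) (measure lebesgue (box a b + box c d))"
proof -
  have "\<forall>i\<in>Basis. a \<bullet> i < b \<bullet> i" "\<forall>i\<in>Basis. c \<bullet> i < d \<bullet> i"
    using assms by (auto simp: box_ne_empty)
  then have "box (a + c) (b + d) \<noteq> {}"
    by (auto simp: box_ne_empty inner_add_left intro: add_strict_mono)
  then have "measure lebesgue (box a b + box c d) = (\<Prod>i\<in>Basis. (b - a) \<bullet> i + (d - c) \<bullet> i)"
    unfolding box_set_plus[OF assms] by (subst measure_lebesgue_box) (auto intro!: prod.cong simp: algebra_simps)
  moreover have "0 < (b - a) \<bullet> i" "0 < (d - c) \<bullet> i" if "i \<in> Basis" for i
    using assms that by (auto simp: box_ne_empty inner_diff_left)
  ultimately show ?thesis
    unfolding measure_lebesgue_box(1)[OF ab] measure_lebesgue_box(1)[OF cd]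
    using root_prod_add_le[of Basis "\<lambda>i. (b - a) \<bullet> i" "\<lambda>i. (d - c) \<bullet> i"] by simp
qed

section \<open>Finite families of disjoint boxes and their cuts by coordinate hyperplanes\<close>

text \<open>Empty members are excluded so that a nonempty family has a union of positive volume and
  \<open>card\<close>, on which the induction runs, counts genuine boxes.\<close>

definition disjoint_boxes :: "'a::euclidean_space set set \<Rightarrow> bool" where
  "disjoint_boxes D \<longleftrightarrow> finite D \<and> disjoint D \<and> {} \<notin> D \<and> (\<forall>X\<in>D. \<exists>a b. X = box a b)"

lemma disjoint_boxes_Union:
  assumes "disjoint_boxes D"
  shows "open (\<Union>D)" "bounded (\<Union>D)" "\<Union>D \<in> lmeasurable"
proof -
  have D: "finite D" "\<And>X. X \<in> D \<Longrightarrow> open X \<and> bounded X"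
    using assms unfolding disjoint_boxes_def by (metis, metis open_box bounded_box)
  show "open (\<Union>D)" using D by (intro open_Union ballI) blast
  moreover show "bounded (\<Union>D)" using D by (intro bounded_Union ballI) blast+
  ultimately show "\<Union>D \<in> lmeasurable" by (simp add: lmeasurable_open)
qed

lemma disjoint_boxes_measure:
  assumes "disjoint_boxes D"
  shows "measure lebesgue (\<Union>D) = (\<Sum>X\<in>D. measure lebesgue X)"
proof (rule measure_Union')
  show "finite D" using assms by (simp add: disjoint_boxes_def)
  show "X \<in> lmeasurable" if "X \<in> D" for X
    using assms that unfolding disjoint_boxes_def by (metis lmeasurable_box)
  show "pairwise disjnt D"
    using assms by (simp add: disjoint_boxes_def disjoint_def pairwise_def disjnt_def)
qed

text \<open>To be applied to open halfspaces \<open>H\<close>. Traces that become empty are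
  discarded, so a halfspace missing some member yields a strictly smaller family; this is what makes
  the induction descend.\<close>

lemma disjoint_boxes_restrict:
  assumes D: "disjoint_boxes D" and H: "\<And>a b. \<exists>c d. box a b \<inter> H = box c d"
  defines "E \<equiv> (\<lambda>X. X \<inter> H) ` D - {{}}"
  shows "disjoint_boxes E" "\<Union>E = \<Union>D \<inter> H" "card E \<le> card D"
    "Y \<in> D \<Longrightarrow> Y \<inter> H = {} \<Longrightarrow> card E < card D"
proof -
  have fin: "finite D" using D by (simp add: disjoint_boxes_def)
  show "disjoint_boxes E"
    unfolding disjoint_boxes_def
  proof (intro conjI ballI)
    show "disjoint E"
    proof (rule disjointI)
      fix X Y assume "X \<in> E" "Y \<in> E" "X \<noteq> Y"
      then obtain X' Y' where XY: "X' \<in> D" "Y' \<in> D" "X = X' \<inter> H" "Y = Y' \<inter> H" "X' \<noteq> Y'"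
        by (auto simp: E_def)
      then have "X' \<inter> Y' = {}" using D by (meson disjointD disjoint_boxes_def)
      with XY show "X \<inter> Y = {}" by blast
    qed
    show "\<exists>a b. X = box a b" if "X \<in> E" for X
    proof -
      from that obtain Y where "Y \<in> D" "X = Y \<inter> H" by (auto simp: E_def)
      with D H show ?thesis unfolding disjoint_boxes_def by metis
    qed
  qed (auto simp: E_def fin)
  show "\<Union>E = \<Union>D \<inter> H" by (auto simp: E_def)
  show "card E \<le> card D"
    unfolding E_def by (meson card_Diff1_le card_image_le fin finite_imageI order_trans)
  assume Y: "Y \<in> D" "Y \<inter> H = {}"
  then have "E \<subseteq> (\<lambda>X. X \<inter> H) ` (D - {Y})" by (auto simp: E_def)
  then have "card E \<le> card (D - {Y})"
    using fin by (meson card_image_le card_mono finite_Diff finite_imageI order_trans)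
  also have "\<dots> < card D" using fin Y by (meson card_Diff1_less)
  finally show "card E < card D" .
qed

text \<open>Both halfspaces are open, so that they cut open boxes into open boxes; the hyperplane
  left out between them is negligible.\<close>

lemma measure_split_hyperplane:
  fixes A :: "'a::euclidean_space set"
  assumes "A \<in> lmeasurable" "i \<in> Basis"
  shows "measure lebesgue A = measure lebesgue (A \<inter> {x. x \<bullet> i < t}) + measure lebesgue (A \<inter> {x. t < x \<bullet> i})"
proof -
  have o: "{x::'a. x \<bullet> i < t} \<in> sets lebesgue" "{x::'a. t < x \<bullet> i} \<in> sets lebesgue"
    by (auto intro!: borel_open open_Collect_less continuous_intros)
  have m: "A \<inter> {x. x \<bullet> i < t} \<in> lmeasurable" "A \<inter> {x. t < x \<bullet> i} \<in> lmeasurable"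
    using assms(1) o by (auto intro: fmeasurable_Int_fmeasurable)
  have disj: "(A \<inter> {x. x \<bullet> i < t}) \<inter> (A \<inter> {x. t < x \<bullet> i}) = {}"
    by auto
  have "negligible {x::'a. x \<bullet> i = t}"
    using assms(2) by (rule negligible_standard_hyperplane)
  then have "measure lebesgue A = measure lebesgue ((A \<inter> {x. x \<bullet> i < t}) \<union> (A \<inter> {x. t < x \<bullet> i}))"
    using assms(1) m
    by (intro measure_negligible_symdiff) (auto elim!: negligible_subset)
  also have "\<dots> = measure lebesgue (A \<inter> {x. x \<bullet> i < t}) + measure lebesgue (A \<inter> {x. t < x \<bullet> i})"
    using m measure_Un3[OF m] by (simp only: disj measure_empty diff_0_right)
  finally show ?thesis .
qed

lemma open_set_plus:
  fixes S T :: "'a::real_normed_vector set"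
  assumes "open S"
  shows "open (S + T)"
proof -
  have "S + T = (\<Union>x\<in>S. \<Union>y\<in>T. {x + y})" by (auto simp: set_plus_def)
  with open_sums[of S T] assms show ?thesis by simp
qed

lemma bounded_set_plus:
  fixes S T :: "'a::real_normed_vector set"
  assumes "bounded S" "bounded T"
  shows "bounded (S + T)"
  using bounded_plus[OF assms] by (simp add: set_plus_image)

lemma disjoint_boxes_measure_pos:
  assumes "disjoint_boxes D" "D \<noteq> {}"
  shows "0 < measure lebesgue (\<Union>D)"
  unfolding disjoint_boxes_measure[OF assms(1)]
proof (rule sum_pos)
  show "0 < measure lebesgue X" if "X \<in> D" for X
    using assms(1) that unfolding disjoint_boxes_def by (metis measure_lebesgue_box(2))
qed (use assms in \<open>auto simp: disjoint_boxes_def\<close>)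

text \<open>Only the \<open>i\<close>-th side depends on \<open>t\<close>: the volume is its
  truncated length times a constant. The \<open>max 0\<close> covers the values of \<open>t\<close>
  at which the halfspace misses the box.\<close>

lemma continuous_measure_box_halfspace:
  fixes a b i :: "'a::euclidean_space"
  assumes i: "i \<in> Basis"
  shows "continuous_on UNIV (\<lambda>t. measure lebesgue (box a b \<inter> {x. x \<bullet> i < t}))"
proof (cases "box a b = {}")
  case False
  then have ab: "a \<bullet> j < b \<bullet> j" if "j \<in> Basis" for j
    using that by (auto simp: box_ne_empty)
  have "measure lebesgue (box a b \<inter> {x. x \<bullet> i < t}) =
      max 0 (min (b \<bullet> i) t - a \<bullet> i) * (\<Prod>j\<in>Basis - {i}. (b - a) \<bullet> j)" for t
  proof (cases "a \<bullet> i < t")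
    case True
    let ?c = "b + (min (b \<bullet> i) t - b \<bullet> i) *\<^sub>R i"
    have c: "?c \<bullet> j = (if j = i then min (b \<bullet> i) t else b \<bullet> j)" if "j \<in> Basis" for j
      using that i by (simp add: inner_add_left inner_Basis)
    have ne: "box a ?c \<noteq> {}"
      unfolding box_ne_empty using True ab by (simp add: c)
    have "(\<Prod>j\<in>Basis. (?c - a) \<bullet> j) = (?c - a) \<bullet> i * (\<Prod>j\<in>Basis - {i}. (?c - a) \<bullet> j)"
      using i by (intro prod.remove) auto
    also have "(\<Prod>j\<in>Basis - {i}. (?c - a) \<bullet> j) = (\<Prod>j\<in>Basis - {i}. (b - a) \<bullet> j)"
      by (intro prod.cong refl) (simp add: inner_diff_left c)
    also have "(?c - a) \<bullet> i = max 0 (min (b \<bullet> i) t - a \<bullet> i)"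
      using True ab[OF i] by (simp add: inner_diff_left c[OF i])
    finally show ?thesis
      by (simp only: box_Int_lower_halfspace[OF i] measure_lebesgue_box(1)[OF ne])
  next
    case False
    then have "box a b \<inter> {x. x \<bullet> i < t} = {}"
      using i by (force simp: mem_box)
    then show ?thesis using False by simp
  qed
  then show ?thesis by (simp only:) (intro continuous_intros)
qed simp

text \<open>Intermediate value theorem: the volume below the hyperplane is continuous in
  \<open>t\<close>, being a finite sum over boxes, and since the union is bounded it runs from 0 to
  the full volume.\<close>

lemma disjoint_boxes_balance:
  fixes E :: "'a::euclidean_space set set"
  assumes E: "disjoint_boxes E" and i: "i \<in> Basis" and u: "0 \<le> u" "u \<le> 1"
  obtains t where "measure lebesgue (\<Union>E \<inter> {x. x \<bullet> i < t}) = u * measure lebesgue (\<Union>E)"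
proof -
  define f where "f t = measure lebesgue (\<Union>E \<inter> {x. x \<bullet> i < t})" for t
  have f: "f t = (\<Sum>X\<in>E. measure lebesgue (X \<inter> {x. x \<bullet> i < t}))" for t
  proof -
    have *: "\<Union>E \<inter> {x. x \<bullet> i < t} = (\<Union>X\<in>E. X \<inter> {x. x \<bullet> i < t})" by blast
    show ?thesis
      unfolding f_def *
    proof (rule measure_UNION')
      show "finite E" using E by (simp add: disjoint_boxes_def)
      show "X \<inter> {x. x \<bullet> i < t} \<in> lmeasurable" if "X \<in> E" for X
        using E that unfolding disjoint_boxes_def by (metis box_Int_lower_halfspace[OF i] lmeasurable_box)
      show "pairwise (\<lambda>X Y. disjnt (X \<inter> {x. x \<bullet> i < t}) (Y \<inter> {x. x \<bullet> i < t})) E"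
        using E by (fastforce simp: disjoint_boxes_def disjoint_def pairwise_def disjnt_def)
    qed
  qed
  have cont: "continuous_on {s..t} f" for s t
    unfolding f
  proof (rule continuous_on_sum)
    show "continuous_on {s..t} (\<lambda>t. measure lebesgue (X \<inter> {x. x \<bullet> i < t}))" if "X \<in> E" for X
      using E that continuous_measure_box_halfspace[OF i] unfolding disjoint_boxes_def
      by (metis continuous_on_subset subset_UNIV)
  qed
  obtain r where "0 < r" and r: "\<And>x. x \<in> \<Union>E \<Longrightarrow> norm x < r"
    using disjoint_boxes_Union(2)[OF E] unfolding bounded_pos_less by blast
  have r': "- r < x \<bullet> i" "x \<bullet> i < r" if "x \<in> \<Union>E" for x
    using r[OF that] Basis_le_norm[OF i, of x] by auto
  have "\<Union>E \<inter> {x. x \<bullet> i < - r} = {}" "\<Union>E \<inter> {x. x \<bullet> i < r} = \<Union>E"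
    using r' by force+
  then have "f (- r) = 0" "f r = measure lebesgue (\<Union>E)"
    by (simp_all only: f_def measure_empty)
  then have "\<exists>t\<ge>- r. t \<le> r \<and> f t = u * measure lebesgue (\<Union>E)"
    using u \<open>0 < r\<close> by (intro IVT' cont) (auto intro: mult_left_le_one_le)
  then show ?thesis using that unfolding f_def by blast
qed

text \<open>Two disjoint nonempty boxes have disjoint side intervals in some coordinate. The
  hyperplane through the right end of the left interval separates them strictly, because the boxes
  are open.\<close>

lemma disjoint_boxes_separate:
  assumes D: "disjoint_boxes D" and "2 \<le> card D"
  obtains i t X Y where "i \<in> Basis" "X \<in> D" "Y \<in> D" "X \<subseteq> {x. x \<bullet> i < t}" "Y \<subseteq> {x. t < x \<bullet> i}"
proof -
  from assms obtain X Y where XY: "X \<in> D" "Y \<in> D" "X \<noteq> Y"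
    by (metis card_le_Suc0_iff_eq disjoint_boxes_def not_less_eq_eq numeral_2_eq_2)
  with D have "X \<inter> Y = {}" "X \<noteq> {}" "Y \<noteq> {}"
    unfolding disjoint_boxes_def by (auto dest: disjointD)
  moreover from D XY obtain a b c d where X: "X = box a b" and Y: "Y = box c d"
    unfolding disjoint_boxes_def by metis
  ultimately obtain i where i: "i \<in> Basis" "b \<bullet> i \<le> c \<bullet> i \<or> d \<bullet> i \<le> a \<bullet> i"
    unfolding X Y disjoint_interval box_ne_empty by (meson not_less)
  show ?thesis
  proof (cases "b \<bullet> i \<le> c \<bullet> i")
    case True
    then have "X \<subseteq> {x. x \<bullet> i < b \<bullet> i}" "Y \<subseteq> {x. b \<bullet> i < x \<bullet> i}"
      using i by (force simp: X Y mem_box)+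
    then show ?thesis using that i XY by blast
  next
    case False
    then have "Y \<subseteq> {x. x \<bullet> i < d \<bullet> i}" "X \<subseteq> {x. d \<bullet> i < x \<bullet> i}"
      using i by (force simp: X Y mem_box)+
    then show ?thesis using that i XY by blast
  qed
qed

text \<open>The cut of \<open>\<Union>D\<close> by a hyperplane separating two of its boxes is matched by a parallel cut of
  \<open>\<Union>E\<close> in the same volume ratio. Both sides scale alike, and their sums lie on opposite sides of
  a hyperplane.\<close>

lemma Brunn_Minkowski_disjoint_boxes_step:
  fixes D E :: "'a::euclidean_space set set"
  defines "BM \<equiv> \<lambda>D E :: 'a set set. (root DIM('a) (measure lebesgue (\<Union>D)) + root DIM('a) (measure lebesgue (\<Union>E))) ^ DIM('a)
      \<le> measure lebesgue (\<Union>D + \<Union>E)"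
  assumes D: "disjoint_boxes D" "2 \<le> card D" and E: "disjoint_boxes E" "E \<noteq> {}"
    and IH: "\<And>D' E'. disjoint_boxes D' \<Longrightarrow> disjoint_boxes E' \<Longrightarrow> D' \<noteq> {} \<Longrightarrow> E' \<noteq> {} \<Longrightarrow>
      card D' < card D \<Longrightarrow> card E' \<le> card E \<Longrightarrow> BM D' E'"
  shows "BM D E"
proof -
  let ?m = "measure (lebesgue :: 'a measure)" and ?n = "DIM('a)"
  obtain i t X Y where i: "i \<in> Basis" and XY: "X \<in> D" "Y \<in> D"
      "X \<subseteq> {x. x \<bullet> i < t}" "Y \<subseteq> {x. t < x \<bullet> i}"
    using disjoint_boxes_separate[OF D] .
  have XYne: "X \<noteq> {}" "Y \<noteq> {}" using XY D(1) unfolding disjoint_boxes_def by auto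
  let ?L = "\<lambda>t. {x. x \<bullet> i < t}" and ?U = "\<lambda>t. {x. t < x \<bullet> i}"
  have L: "\<exists>c d. box a b \<inter> ?L t = box c d" and U: "\<exists>c d. box a b \<inter> ?U t = box c d" for a b t
    using box_Int_lower_halfspace[OF i] box_Int_upper_halfspace[OF i] by metis+
  define cut where "cut F H = (\<lambda>X. X \<inter> H) ` F - {{}}" for F :: "'a set set" and H
  have cutL: "disjoint_boxes (cut F (?L t))" "\<Union>(cut F (?L t)) = \<Union>F \<inter> ?L t"
      "card (cut F (?L t)) \<le> card F"
      "Y \<in> F \<Longrightarrow> Y \<inter> ?L t = {} \<Longrightarrow> card (cut F (?L t)) < card F"
    if "disjoint_boxes F" for F t Y
    using disjoint_boxes_restrict[OF that L] unfolding cut_def by blast+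
  have cutU: "disjoint_boxes (cut F (?U t))" "\<Union>(cut F (?U t)) = \<Union>F \<inter> ?U t"
      "card (cut F (?U t)) \<le> card F"
      "Y \<in> F \<Longrightarrow> Y \<inter> ?U t = {} \<Longrightarrow> card (cut F (?U t)) < card F"
    if "disjoint_boxes F" for F t Y
    using disjoint_boxes_restrict[OF that U] unfolding cut_def by blast+
  let ?D1 = "cut D (?L t)" and ?D2 = "cut D (?U t)"
  have ne: "?D1 \<noteq> {}" "?D2 \<noteq> {}" using XY XYne by (auto simp: cut_def)
  have "Y \<inter> ?L t = {}" "X \<inter> ?U t = {}" using XY by force+
  with XY have cardD: "card ?D1 < card D" "card ?D2 < card D"
    using cutL(4)[OF D(1)] cutU(4)[OF D(1)] by blast+
  define u where "u = ?m (\<Union>D \<inter> ?L t) / ?m (\<Union>D)"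
  have D12: "?m (\<Union>D) = ?m (\<Union>D \<inter> ?L t) + ?m (\<Union>D \<inter> ?U t)"
    by (rule measure_split_hyperplane[OF disjoint_boxes_Union(3)[OF D(1)] i])
  have pos: "0 < ?m (\<Union>D \<inter> ?L t)" "0 < ?m (\<Union>D \<inter> ?U t)"
    using disjoint_boxes_measure_pos[OF cutL(1)[OF D(1)] ne(1)]
      disjoint_boxes_measure_pos[OF cutU(1)[OF D(1)] ne(2)] cutL(2)[OF D(1)] cutU(2)[OF D(1)] by simp_all
  have u: "0 < u" "u < 1" using pos D12 by (auto simp: u_def)
  have D1: "?m (\<Union>D \<inter> ?L t) = u * ?m (\<Union>D)" and D2: "?m (\<Union>D \<inter> ?U t) = (1 - u) * ?m (\<Union>D)"
    using pos D12 by (auto simp: u_def field_simps)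
  obtain s where E1: "?m (\<Union>E \<inter> ?L s) = u * ?m (\<Union>E)"
    using disjoint_boxes_balance[OF E(1) i] u by (metis less_imp_le)
  moreover have "?m (\<Union>E) = ?m (\<Union>E \<inter> ?L s) + ?m (\<Union>E \<inter> ?U s)"
    by (rule measure_split_hyperplane[OF disjoint_boxes_Union(3)[OF E(1)] i])
  ultimately have E2: "?m (\<Union>E \<inter> ?U s) = (1 - u) * ?m (\<Union>E)"
    by (simp add: algebra_simps)
  let ?E1 = "cut E (?L s)" and ?E2 = "cut E (?U s)"
  have Epos: "0 < ?m (\<Union>E)" by (rule disjoint_boxes_measure_pos[OF E])
  \<comment> \<open>The cut of \<open>E\<close> is placed by volume and need not miss any member.
    Hence its parts are nonempty because their volumes are positive, and their cardinality is only
    bounded by \<open>card E\<close>; the strict descent comes from \<open>D\<close>.\<close>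
  have "0 < ?m (\<Union>?E1)" "0 < ?m (\<Union>?E2)"
    unfolding cutL(2)[OF E(1)] cutU(2)[OF E(1)] E1 E2 using u Epos by simp_all
  then have neE: "?E1 \<noteq> {}" "?E2 \<noteq> {}" by force+
  let ?R = "(root ?n (?m (\<Union>D)) + root ?n (?m (\<Union>E))) ^ ?n"
  \<comment> \<open>In the form with the \<open>n\<close>-th power the bound is homogeneous of
    degree one in the volumes, so the bounds for the two halves add up with weights \<open>u\<close>
    and \<open>1 - u\<close>.\<close>
  have scale: "(root ?n (v * x) + root ?n (v * y)) ^ ?n = v * (root ?n x + root ?n y) ^ ?n"
    if "0 \<le> v" for v x y
    using that by (simp add: real_root_mult power_mult_distrib flip: distrib_left)
  let ?A1 = "\<Union>D \<inter> ?L t" and ?A2 = "\<Union>D \<inter> ?U t" and ?B1 = "\<Union>E \<inter> ?L s" and ?B2 = "\<Union>E \<inter> ?U s"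
  let ?S = "\<Union>D + \<Union>E"
  have "BM ?D1 ?E1"
    using IH[OF cutL(1)[OF D(1)] cutL(1)[OF E(1)] ne(1) neE(1) cardD(1) cutL(3)[OF E(1)]] .
  then have 1: "u * ?R \<le> ?m (?A1 + ?B1)"
    using u unfolding BM_def cutL(2)[OF D(1)] cutL(2)[OF E(1)] D1 E1 by (simp only: scale less_imp_le)
  have "BM ?D2 ?E2"
    using IH[OF cutU(1)[OF D(1)] cutU(1)[OF E(1)] ne(2) neE(2) cardD(2) cutU(3)[OF E(1)]] .
  then have 2: "(1 - u) * ?R \<le> ?m (?A2 + ?B2)"
    using u unfolding BM_def cutU(2)[OF D(1)] cutU(2)[OF E(1)] D2 E2 by (simp only: scale less_imp_le diff_ge_0_iff_ge)
  have "open ?S" "bounded ?S"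
    using disjoint_boxes_Union[OF D(1)] disjoint_boxes_Union[OF E(1)]
    by (auto intro: open_set_plus bounded_set_plus)
  then have S: "?S \<in> lmeasurable" by (simp add: lmeasurable_open)
  have H: "open (?L r)" "open (?U r)" for r
    by (auto intro!: open_Collect_less continuous_intros)
  have "?A1 + ?B1 \<subseteq> ?S \<inter> ?L (t + s)" "?A2 + ?B2 \<subseteq> ?S \<inter> ?U (t + s)"
    by (auto elim!: set_plus_elim intro!: set_plus_intro add_strict_mono simp: inner_add_left)
  moreover have "open (?A1 + ?B1)" "open (?A2 + ?B2)"
    using disjoint_boxes_Union(1)[OF D(1)] H by (auto intro!: open_set_plus)
  moreover have "?S \<inter> ?L (t + s) \<in> lmeasurable" "?S \<inter> ?U (t + s) \<in> lmeasurable"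
    using S H by (auto intro: fmeasurable_Int_fmeasurable)
  ultimately have "?m (?A1 + ?B1) \<le> ?m (?S \<inter> ?L (t + s))" "?m (?A2 + ?B2) \<le> ?m (?S \<inter> ?U (t + s))"
    by (meson measure_mono_fmeasurable borel_open sets_completionI_sets lborelD)+
  with 1 2 measure_split_hyperplane[OF S i, of "t + s"] have "u * ?R + (1 - u) * ?R \<le> ?m ?S"
    by linarith
  then show ?thesis unfolding BM_def by (simp add: algebra_simps)
qed

text \<open>Induction on the total number of boxes. Whichever family has at least two members is
  cut, the second one by commutativity of the sum; two single boxes are the base case.\<close>

lemma Brunn_Minkowski_disjoint_boxes:
  fixes D E :: "'a::euclidean_space set set"
  assumes "disjoint_boxes D" "D \<noteq> {}" "disjoint_boxes E" "E \<noteq> {}"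
  shows "(root DIM('a) (measure lebesgue (\<Union>D)) + root DIM('a) (measure lebesgue (\<Union>E))) ^ DIM('a)
      \<le> measure lebesgue (\<Union>D + \<Union>E)"
  using assms
proof (induction "card D + card E" arbitrary: D E rule: less_induct)
  case less
  have card: "card D > 0" "card E > 0"
    using less.prems by (auto simp: card_gt_0_iff disjoint_boxes_def)
  consider "2 \<le> card D" | "2 \<le> card E" | "card D = 1" "card E = 1"
    using card by linarith
  then show ?case
  proof cases
    case 1
    show ?thesis
      by (rule Brunn_Minkowski_disjoint_boxes_step) (use less 1 in auto)
  next
    case 2
    have "(root DIM('a) (measure lebesgue (\<Union>E)) + root DIM('a) (measure lebesgue (\<Union>D))) ^ DIM('a)
        \<le> measure lebesgue (\<Union>E + \<Union>D)"
      by (rule Brunn_Minkowski_disjoint_boxes_step) (use less 2 in auto)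
    then show ?thesis by (simp add: add.commute)
  next
    case 3
    then obtain X Y where DE: "D = {X}" "E = {Y}" by (meson card_1_singletonE)
    with less.prems obtain a b c d where "X = box a b" "Y = box c d" and "X \<noteq> {}" "Y \<noteq> {}"
      unfolding disjoint_boxes_def by (metis singletonI)
    with Brunn_Minkowski_box[of a b c d]
    have "root DIM('a) (measure lebesgue X) + root DIM('a) (measure lebesgue Y)
      \<le> root DIM('a) (measure lebesgue (X + Y))" by simp
    then have "(root DIM('a) (measure lebesgue X) + root DIM('a) (measure lebesgue Y)) ^ DIM('a)
      \<le> root DIM('a) (measure lebesgue (X + Y)) ^ DIM('a)"
      by (intro power_mono) auto
    then show ?thesis by (simp add: DE)
  qed
qed

subsection \<open>The Brunn-Minkowski inequality for convex sets\<close>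

text \<open>Intersecting with a large ball makes the set bounded at a small loss of volume. The
  bounded open set is tiled by countably many closed boxes with disjoint interiors; by continuity
  from below finitely many of them suffice, and passing to their interiors loses only a null
  set.\<close>

lemma open_inner_disjoint_boxes:
  fixes U :: "'a::euclidean_space set"
  assumes "open U" and v: "v < emeasure lebesgue U"
  obtains D where "disjoint_boxes D" "\<Union>D \<subseteq> U" "v < emeasure lebesgue (\<Union>D)"
proof -
  define V where "V k = U \<inter> ball 0 (real k)" for k
  have oV: "open (V k)" for k using assms(1) by (auto simp: V_def)
  have "(\<Union>k. V k) = U"
  proof -
    have "\<exists>k. norm x < real k" for x :: 'a using reals_Archimedean2 by blast
    then show ?thesis by (auto simp: V_def)
  qed
  moreover have "incseq V" by (auto simp: incseq_def V_def)
  moreover have "range V \<subseteq> sets lebesgue" using oV by auto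
  ultimately have "v < (SUP k. emeasure lebesgue (V k))"
    using v by (simp only: SUP_emeasure_incseq)
  then obtain k where k: "v < emeasure lebesgue (V k)" by (auto simp: less_SUP_iff)
  define W where "W = V k"
  have W: "open W" "W \<subseteq> U" "v < emeasure lebesgue W" "bounded W"
    using oV k by (auto simp: W_def V_def)
  then have "W \<noteq> {}" by auto
  obtain a where a: "W \<subseteq> box (- a) a"
    using bounded_subset_box_symmetric[OF \<open>bounded W\<close>] by blast
  then have "W \<subseteq> cbox (- a) a" "box (- a) a \<noteq> {}" using \<open>W \<noteq> {}\<close> box_subset_cbox by blast+
  \<comment> \<open>The covering lemma puts each tile inside the gauge set of one of its points in
    \<open>W\<close>. Taking \<open>W\<close> itself as that gauge set keeps all tiles within
    \<open>W\<close>.\<close>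
  moreover have "gauge (\<lambda>x. if x \<in> W then W else UNIV)" using W(1) by (auto simp: gauge_def)
  ultimately obtain D where D: "countable D"
      "\<And>K. K \<in> D \<Longrightarrow> interior K \<noteq> {} \<and> (\<exists>c d. K = cbox c d)"
      "pairwise (\<lambda>A B. interior A \<inter> interior B = {}) D"
      "\<And>K. K \<in> D \<Longrightarrow> \<exists>x \<in> W \<inter> K. K \<subseteq> (if x \<in> W then W else UNIV)"
      "W \<subseteq> \<Union>D"
    by (rule covering_lemma) blast
  have DW: "K \<subseteq> W" if "K \<in> D" for K using D(4)[OF that] by (auto split: if_splits)
  have "D \<noteq> {}" using D(5) \<open>W \<noteq> {}\<close> by auto
  have Dsets: "K \<in> sets lebesgue" if "K \<in> D" for K
    using D(2)[OF that] by (metis lmeasurable_cbox fmeasurableD)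
  \<comment> \<open>\<open>from_nat_into D\<close> enumerates \<open>D\<close>, with repetitions if
    \<open>D\<close> is finite, so the unions \<open>P N\<close> increase to
    \<open>\<Union>D\<close>.\<close>
  define P where "P N = \<Union>(from_nat_into D ` {..N})" for N :: nat
  have "(\<Union>N. P N) = \<Union>D"
  proof -
    have "(\<Union>N. P N) = \<Union>(range (from_nat_into D))" by (auto simp: P_def)
    then show ?thesis using D(1) \<open>D \<noteq> {}\<close> by simp
  qed
  moreover have "incseq P"
    unfolding incseq_def P_def by (intro allI impI Union_mono image_mono) simp
  moreover have "range P \<subseteq> sets lebesgue"
  proof -
    have "P N \<in> sets lebesgue" for N
      unfolding P_def by (intro sets.finite_Union) (use Dsets from_nat_into[OF \<open>D \<noteq> {}\<close>] in blast)+
    then show ?thesis by blast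
  qed
  moreover have "\<Union>D = W" using DW D(5) by blast
  ultimately have "v < (SUP N. emeasure lebesgue (P N))"
    using W(3) by (simp only: SUP_emeasure_incseq)
  then obtain N where N: "v < emeasure lebesgue (P N)" by (auto simp: less_SUP_iff)
  define F where "F = from_nat_into D ` {..N}"
  have F: "finite F" "F \<subseteq> D" "v < emeasure lebesgue (\<Union>F)"
    using N from_nat_into[OF \<open>D \<noteq> {}\<close>] by (auto simp: F_def P_def)
  let ?I = "interior ` F"
  have I: "disjoint_boxes ?I"
    unfolding disjoint_boxes_def
  proof (intro conjI ballI)
    show "disjoint ?I"
    proof (rule disjointI)
      fix X Y assume "X \<in> ?I" "Y \<in> ?I" "X \<noteq> Y"
      then obtain K L where "K \<in> F" "L \<in> F" "K \<noteq> L" "X = interior K" "Y = interior L" by blast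
      then show "X \<inter> Y = {}" using F(2) pairwiseD[OF D(3), of K L] by blast
    qed
    show "{} \<notin> ?I" using D(2) F(2) by auto
    show "\<exists>a b. X = box a b" if "X \<in> ?I" for X
      using that D(2) F(2) interior_cbox by (metis imageE subsetD)
  qed (use F(1) in auto)
  moreover have "\<Union>?I \<subseteq> U" using DW F(2) W(2) interior_subset by fastforce
  moreover have "v < emeasure lebesgue (\<Union>?I)"
  proof -
    have neg: "negligible (K - interior K)" if "K \<in> F" for K
      using that F(2) D(2) by (metis interior_cbox negligible_frontier_interval subsetD)
    then have neg: "negligible (\<Union>K\<in>F. K - interior K)"
      using F(1) by (auto intro: negligible_Union)
    have "emeasure lebesgue (\<Union>F) \<le> emeasure lebesgue (\<Union>?I \<union> (\<Union>K\<in>F. K - interior K))"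
      using disjoint_boxes_Union(3)[OF I] neg
      by (intro emeasure_mono sets.Un) (auto intro: negligible_imp_sets)
    also have "\<dots> \<le> emeasure lebesgue (\<Union>?I) + emeasure lebesgue (\<Union>K\<in>F. K - interior K)"
      using disjoint_boxes_Union(3)[OF I] neg
      by (intro emeasure_subadditive) (auto intro: negligible_imp_sets)
    also have "emeasure lebesgue (\<Union>K\<in>F. K - interior K) = 0"
      using neg negligible_iff_emeasure0 negligible_imp_sets by blast
    finally show ?thesis using F(3) by simp
  qed
  ultimately show ?thesis using that by blast
qed

text \<open>It suffices to prove the bound with the left side multiplied by an arbitrary
  \<open>k\<close> between 0 and 1. This slack is spent on replacing \<open>A\<close> and
  \<open>B\<close> by disjoint unions of boxes inside them.\<close>

lemma Brunn_Minkowski_open: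
  fixes A B :: "'a::euclidean_space set"
  assumes AB: "open A" "open B" and m: "A \<in> lmeasurable" "B \<in> lmeasurable" "A + B \<in> lmeasurable"
    and pos: "0 < measure lebesgue A" "0 < measure lebesgue B"
  shows "root DIM('a) (measure lebesgue A) + root DIM('a) (measure lebesgue B)
    \<le> root DIM('a) (measure lebesgue (A + B))"
proof (rule field_le_mult_one_interval)
  fix k :: real assume k: "0 < k" "k < 1"
  let ?n = "DIM('a)" and ?m = "measure (lebesgue :: 'a measure)"
  have approx: "\<exists>D. disjoint_boxes D \<and> D \<noteq> {} \<and> \<Union>D \<subseteq> X \<and> k * root ?n (?m X) \<le> root ?n (?m (\<Union>D))"
    if X: "open X" "X \<in> lmeasurable" "0 < ?m X" for X
  proof -
    \<comment> \<open>Keeping more than the fraction \<open>k ^ n\<close> of the volume means losing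
      at most the factor \<open>k\<close> after taking the root.\<close>
    have "k ^ ?n < 1" using k by (simp add: power_less_one_iff)
    then have "k ^ ?n * ?m X < ?m X" using X(3) by simp
    then have "ennreal (k ^ ?n * ?m X) < emeasure lebesgue X"
      using k X by (simp add: emeasure_eq_measure2 ennreal_less_iff)
    then obtain D where D: "disjoint_boxes D" "\<Union>D \<subseteq> X" "ennreal (k ^ ?n * ?m X) < emeasure lebesgue (\<Union>D)"
      using open_inner_disjoint_boxes[OF X(1)] by blast
    moreover from D have "D \<noteq> {}" by auto
    moreover have "k ^ ?n * ?m X < ?m (\<Union>D)"
      using D(3) disjoint_boxes_Union(3)[OF D(1)] k X(3)
      by (simp add: emeasure_eq_measure2 ennreal_less_iff)
    then have "root ?n (k ^ ?n * ?m X) \<le> root ?n (?m (\<Union>D))" by simp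
    then have "k * root ?n (?m X) \<le> root ?n (?m (\<Union>D))"
      using k by (simp add: real_root_mult real_root_power_cancel)
    ultimately show ?thesis by blast
  qed
  obtain D where D: "disjoint_boxes D" "D \<noteq> {}" "\<Union>D \<subseteq> A" "k * root ?n (?m A) \<le> root ?n (?m (\<Union>D))"
    using approx[OF AB(1) m(1) pos(1)] by blast
  obtain E where E: "disjoint_boxes E" "E \<noteq> {}" "\<Union>E \<subseteq> B" "k * root ?n (?m B) \<le> root ?n (?m (\<Union>E))"
    using approx[OF AB(2) m(2) pos(2)] by blast
  have "open (\<Union>D + \<Union>E)" by (intro open_set_plus disjoint_boxes_Union D)
  then have s: "\<Union>D + \<Union>E \<in> sets lebesgue" by auto
  have "(k * (root ?n (?m A) + root ?n (?m B))) ^ ?n \<le> (root ?n (?m (\<Union>D)) + root ?n (?m (\<Union>E))) ^ ?n"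
    using D(4) E(4) k pos by (intro power_mono) (simp_all add: distrib_left)
  also have "\<dots> \<le> ?m (\<Union>D + \<Union>E)"
    by (rule Brunn_Minkowski_disjoint_boxes[OF D(1,2) E(1,2)])
  also have "\<dots> \<le> ?m (A + B)"
    by (intro measure_mono_fmeasurable set_plus_mono2 D(3) E(3) s m(3))
  finally have "root ?n ((k * (root ?n (?m A) + root ?n (?m B))) ^ ?n) \<le> root ?n (?m (A + B))" by simp
  then show "k * (root ?n (?m A) + root ?n (?m B)) \<le> root ?n (?m (A + B))"
    using k pos by (simp add: real_root_power_cancel)
qed

text \<open>The frontier of a convex set is negligible, so the set differs from its open interior by
  a null set. This carries results on open sets over to all convex sets.\<close>

lemma lebesgue_convex:
  fixes S :: "'a::euclidean_space set"
  assumes "convex S"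
  shows "S \<in> sets lebesgue" and "emeasure lebesgue S = emeasure lebesgue (interior S)"
proof -
  have neg: "negligible (S - interior S)"
    using negligible_convex_frontier[OF assms] by (rule negligible_subset) (auto simp: frontier_def closure_def)
  have S: "S = interior S \<union> (S - interior S)" using interior_subset by blast
  show "S \<in> sets lebesgue"
    by (subst S) (intro sets.Un negligible_imp_sets[OF neg], auto)
  show "emeasure lebesgue S = emeasure lebesgue (interior S)"
    by (subst S, rule emeasure_Un_null_set) (use neg negligible_iff_null_sets in auto)
qed

text \<open>The sum contains a translate of \<open>B\<close>.\<close>

lemma emeasure_le_set_plus:
  fixes A B :: "'a::euclidean_space set"
  assumes "A \<noteq> {}" "A + B \<in> sets lebesgue"
  shows "emeasure lebesgue B \<le> emeasure lebesgue (A + B)"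
proof -
  from assms obtain a where "a \<in> A" by blast
  have "emeasure lebesgue B = emeasure lebesgue ((\<lambda>x. 1 *\<^sub>R x + a) ` B)"
    unfolding emeasure_lebesgue_affine by simp
  also have "\<dots> \<le> emeasure lebesgue (A + B)"
    using \<open>a \<in> A\<close> by (intro emeasure_mono assms) (auto simp: add.commute[of _ a] intro: set_plus_intro)
  finally show ?thesis .
qed

section \<open>The root on extended nonnegative reals\<close>

lemma ennreal_root_ennreal: "0 \<le> x \<Longrightarrow> ennreal_root n (ennreal x) = ennreal (root n x)"
  by (simp add: ennreal_root_def)

lemma ennreal_root_0 [simp]: "ennreal_root n 0 = 0"
  by (simp add: ennreal_root_def)

lemma ennreal_root_top [simp]: "ennreal_root n top = top"
  by (simp add: ennreal_root_def)

lemma ennreal_root_mono: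
  assumes "0 < n" "x \<le> y"
  shows "ennreal_root n x \<le> ennreal_root n y"
proof (cases "y = \<infinity>")
  case False
  with assms have "x \<noteq> \<infinity>" by (auto simp: top_unique)
  with False assms show ?thesis
    by (auto simp: ennreal_root_def less_top intro!: ennreal_leI enn2real_mono)
qed simp

lemma ennreal_root_power_mult:
  assumes n: "0 < n" and c: "0 \<le> c"
  shows "ennreal_root n (ennreal c ^ n * x) = ennreal c * ennreal_root n x"
proof (cases x)
  case (real r)
  have "ennreal c ^ n * x = ennreal (c ^ n * r)"
    using c real by (simp add: ennreal_power ennreal_mult)
  moreover have "ennreal_root n (ennreal (c ^ n * r)) = ennreal (c * root n r)"
    using assms real by (subst ennreal_root_ennreal) (simp_all add: real_root_mult real_root_power_cancel)
  ultimately show ?thesis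
    using assms real by (simp only: ennreal_root_ennreal) (simp add: ennreal_mult)
next
  \<comment> \<open>For \<open>c > 0\<close> both sides are infinite. For \<open>c = 0\<close> both
    vanish, since \<open>0 * \<infinity> = 0\<close> and \<open>0 ^ n = 0\<close> for positive
    \<open>n\<close>.\<close>
  case top
  show ?thesis
  proof (cases "c = 0")
    case False
    with c have "0 < ennreal c" "0 < ennreal c ^ n" by (auto simp: ennreal_power)
    with top show ?thesis by (simp add: ennreal_mult_top)
  qed (use n in \<open>simp add: zero_power\<close>)
qed

text \<open>Nothing is to be shown if the sum has infinite volume; otherwise both summands have
  finite volume. If one of them is null, the sum still contains a translate of the other. In the
  remaining case the interiors have positive volume and the inequality for open sets applies to
  them.\<close>

lemma Brunn_Minkowski_convex:
  fixes A B :: "'a::euclidean_space set"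
  assumes cv: "convex A" "convex B" and ne: "A \<noteq> {}" "B \<noteq> {}"
  shows "ennreal_root DIM('a) (emeasure lebesgue A) + ennreal_root DIM('a) (emeasure lebesgue B)
    \<le> ennreal_root DIM('a) (emeasure lebesgue (A + B))"
proof (cases "emeasure lebesgue (A + B) = \<infinity>")
  case False
  let ?n = "DIM('a)" and ?e = "emeasure (lebesgue :: 'a measure)"
  have S: "A + B \<in> sets lebesgue" by (intro lebesgue_convex convex_set_plus cv)
  have le: "?e B \<le> ?e (A + B)" "?e A \<le> ?e (A + B)"
    using emeasure_le_set_plus[OF ne(1) S] emeasure_le_set_plus[OF ne(2), of A] S by (simp_all add: add.commute)
  with False have lm: "A \<in> lmeasurable" "B \<in> lmeasurable" "A + B \<in> lmeasurable"
    using S lebesgue_convex(1) cv by (auto intro!: fmeasurableI simp: less_top top_unique)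
  consider "?e A = 0" | "?e B = 0" | "?e A \<noteq> 0" "?e B \<noteq> 0" by blast
  then show ?thesis
  proof cases
    case 3
    let ?A = "interior A" and ?B = "interior B"
    have "?A \<in> lmeasurable" "?B \<in> lmeasurable"
      using lm cv by (auto simp: fmeasurable_def lebesgue_convex(2))
    moreover have "?A + ?B \<subseteq> A + B" by (intro set_plus_mono2 interior_subset)
    moreover have "open (?A + ?B)" by (simp add: open_set_plus)
    ultimately have AB: "?A + ?B \<in> lmeasurable"
      using lm by (meson fmeasurableI2 borel_open sets_completionI_sets lborelD)
    have m: "measure lebesgue A = measure lebesgue ?A" "measure lebesgue B = measure lebesgue ?B"
      using cv unfolding measure_def by (simp_all only: lebesgue_convex(2))
    have pos: "0 < measure lebesgue ?A" "0 < measure lebesgue ?B"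
      using 3 lm unfolding m[symmetric] by (simp_all add: emeasure_eq_measure2 zero_less_measure_iff)
    have "root ?n (measure lebesgue ?A) + root ?n (measure lebesgue ?B)
      \<le> root ?n (measure lebesgue (?A + ?B))"
      by (rule Brunn_Minkowski_open) (use pos AB \<open>?A \<in> lmeasurable\<close> \<open>?B \<in> lmeasurable\<close> in auto)
    also have "\<dots> \<le> root ?n (measure lebesgue (A + B))"
      using \<open>?A + ?B \<subseteq> A + B\<close> AB lm by (simp add: measure_mono_fmeasurable fmeasurableD)
    finally show ?thesis
      using lm unfolding m[symmetric]
      by (simp add: emeasure_eq_measure2 ennreal_root_ennreal flip: ennreal_plus)
  qed (use le in \<open>auto intro: ennreal_root_mono\<close>)
qed simp

lemma Brunn_Minkowski_sum:
  fixes A :: "'i \<Rightarrow> 'a::euclidean_space set"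
  assumes "finite I" "\<And>i. i \<in> I \<Longrightarrow> convex (A i)" "\<And>i. i \<in> I \<Longrightarrow> A i \<noteq> {}"
  shows "(\<Sum>i\<in>I. ennreal_root DIM('a) (emeasure lebesgue (A i)))
    \<le> ennreal_root DIM('a) (emeasure lebesgue (\<Sum>i\<in>I. A i))"
  using assms
proof (induction rule: finite_induct)
  case (insert i I)
  have "(\<Sum>j\<in>I. A j) \<noteq> {}"
  proof -
    have "\<forall>j\<in>I. \<exists>x. x \<in> A j" using insert.prems(2) by auto
    then obtain f where "\<forall>j\<in>I. f j \<in> A j" by metis
    then show ?thesis unfolding set_sum_alt[OF insert.hyps(1)] by blast
  qed
  then have "ennreal_root DIM('a) (emeasure lebesgue (A i)) + ennreal_root DIM('a) (emeasure lebesgue (\<Sum>j\<in>I. A j))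
      \<le> ennreal_root DIM('a) (emeasure lebesgue (A i + (\<Sum>j\<in>I. A j)))"
    using insert by (intro Brunn_Minkowski_convex convex_set_sum) auto
  moreover have "(\<Sum>j\<in>I. ennreal_root DIM('a) (emeasure lebesgue (A j)))
    \<le> ennreal_root DIM('a) (emeasure lebesgue (\<Sum>j\<in>I. A j))"
    using insert by auto
  ultimately show ?case
    unfolding sum.insert[OF insert.hyps(1,2)] by (meson add_left_mono order_trans)
qed simp

subsection \<open>Fractional superadditivity\<close>

lemma fractional_Minkowski_sum_subset:
  fixes K :: "'i \<Rightarrow> 'a::real_vector set" and \<beta> :: "'i set \<Rightarrow> real"
  assumes "finite I" "G \<subseteq> Pow I" and cv: "\<And>i. i \<in> I \<Longrightarrow> convex (K i)"
    and nonneg: "\<And>s. s \<in> G \<Longrightarrow> 0 \<le> \<beta> s"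
    and one: "\<And>i. i \<in> I \<Longrightarrow> (\<Sum>s\<in>{s\<in>G. i \<in> s}. \<beta> s) = 1"
  shows "(\<Sum>s\<in>G. (\<lambda>x. \<beta> s *\<^sub>R x) ` (\<Sum>j\<in>s. K j)) \<subseteq> (\<Sum>j\<in>I. K j)"
proof
  have finG: "finite G" using assms(1,2) by (meson finite_Pow_iff finite_subset)
  have fins: "finite s" if "s \<in> G" for s using that assms(1,2) by (meson PowD finite_subset subsetD)
  fix y assume "y \<in> (\<Sum>s\<in>G. (\<lambda>x. \<beta> s *\<^sub>R x) ` (\<Sum>j\<in>s. K j))"
  then obtain f where y: "y = sum f G" and f: "\<forall>s\<in>G. f s \<in> (\<lambda>x. \<beta> s *\<^sub>R x) ` (\<Sum>j\<in>s. K j)"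
    by (auto simp: set_sum_alt[OF finG])
  \<comment> \<open>The representing points \<open>g j\<close> may differ from one \<open>s\<close>
    to another; convexity of \<open>K j\<close> will later merge them into a single point.\<close>
  have "\<forall>s\<in>G. \<exists>g. f s = \<beta> s *\<^sub>R (\<Sum>j\<in>s. g j) \<and> (\<forall>j\<in>s. g j \<in> K j)"
  proof
    fix s assume s: "s \<in> G"
    with f obtain x where "x \<in> (\<Sum>j\<in>s. K j)" "f s = \<beta> s *\<^sub>R x" by blast
    then show "\<exists>g. f s = \<beta> s *\<^sub>R (\<Sum>j\<in>s. g j) \<and> (\<forall>j\<in>s. g j \<in> K j)"
      unfolding set_sum_alt[OF fins[OF s]] by blast
  qed
  then obtain g where g: "\<And>s. s \<in> G \<Longrightarrow> f s = \<beta> s *\<^sub>R (\<Sum>j\<in>s. g s j)"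
      "\<And>s j. s \<in> G \<Longrightarrow> j \<in> s \<Longrightarrow> g s j \<in> K j"
    by metis
  \<comment> \<open>Writing \<open>s\<close> as \<open>{j\<in>I. j \<in> s}\<close> turns the double
    sum into one over incidences, whose order can be exchanged.\<close>
  have "y = (\<Sum>s\<in>G. \<Sum>j\<in>{j\<in>I. j \<in> s}. \<beta> s *\<^sub>R g s j)"
    unfolding y
  proof (rule sum.cong[OF refl])
    fix s assume s: "s \<in> G"
    then have "{j \<in> I. j \<in> s} = s" using assms(2) by blast
    then show "f s = (\<Sum>j\<in>{j\<in>I. j \<in> s}. \<beta> s *\<^sub>R g s j)"
      by (simp only: g(1)[OF s] scaleR_sum_right)
  qed
  also have "\<dots> = (\<Sum>j\<in>I. \<Sum>s\<in>{s\<in>G. j \<in> s}. \<beta> s *\<^sub>R g s j)"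
    by (rule sum.swap_restrict[OF finG \<open>finite I\<close>])
  also have "\<dots> \<in> (\<Sum>j\<in>I. K j)"
  proof -
    have "(\<Sum>s\<in>{s\<in>G. j \<in> s}. \<beta> s *\<^sub>R g s j) \<in> K j" if "j \<in> I" for j
      using finG nonneg g(2) by (intro convex_sum cv one that) auto
    then show ?thesis by (auto simp: set_sum_alt[OF \<open>finite I\<close>])
  qed
  finally show "y \<in> (\<Sum>j\<in>I. K j)" .
qed

section \<open>Sums of homothets and the case of equality\<close>

text \<open>By convexity, \<open>c *\<^sub>R x + d *\<^sub>R y\<close> is \<open>c + d\<close> times
  a convex combination of \<open>x\<close> and \<open>y\<close>, hence lies in the dilate of
  \<open>A\<close> by \<open>c + d\<close>.\<close>

lemma set_plus_homothets:
  fixes A :: "'a::real_vector set"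
  assumes A: "convex A" and c: "0 < c" "0 < d"
  shows "(\<lambda>x. a + c *\<^sub>R x) ` A + (\<lambda>x. b + d *\<^sub>R x) ` A = (\<lambda>x. (a + b) + (c + d) *\<^sub>R x) ` A"
proof
  show "(\<lambda>x. a + c *\<^sub>R x) ` A + (\<lambda>x. b + d *\<^sub>R x) ` A \<subseteq> (\<lambda>x. (a + b) + (c + d) *\<^sub>R x) ` A"
  proof (clarify elim!: set_plus_elim)
    fix x y assume xy: "x \<in> A" "y \<in> A"
    let ?z = "(c / (c + d)) *\<^sub>R x + (d / (c + d)) *\<^sub>R y"
    have "?z \<in> A"
      using A xy c by (intro convexD) (auto simp flip: add_divide_distrib)
    moreover have "(a + c *\<^sub>R x) + (b + d *\<^sub>R y) = (a + b) + (c + d) *\<^sub>R ?z"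
      using c by (simp add: scaleR_add_right)
    ultimately show "(a + c *\<^sub>R x) + (b + d *\<^sub>R y) \<in> (\<lambda>x. (a + b) + (c + d) *\<^sub>R x) ` A" by blast
  qed
  show "(\<lambda>x. (a + b) + (c + d) *\<^sub>R x) ` A \<subseteq> (\<lambda>x. a + c *\<^sub>R x) ` A + (\<lambda>x. b + d *\<^sub>R x) ` A"
  proof clarify
    fix x assume "x \<in> A"
    then have "(a + c *\<^sub>R x) + (b + d *\<^sub>R x) \<in> (\<lambda>x. a + c *\<^sub>R x) ` A + (\<lambda>x. b + d *\<^sub>R x) ` A"
      by (intro set_plus_intro imageI)
    then show "(a + b) + (c + d) *\<^sub>R x \<in> (\<lambda>x. a + c *\<^sub>R x) ` A + (\<lambda>x. b + d *\<^sub>R x) ` A"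
      by (simp add: scaleR_add_left algebra_simps)
  qed
qed

lemma sum_homothets:
  fixes A :: "'a::real_vector set"
  assumes "finite I" "I \<noteq> {}" "convex A" "\<And>i. i \<in> I \<Longrightarrow> 0 < c i"
  shows "(\<Sum>i\<in>I. (\<lambda>x. a i + c i *\<^sub>R x) ` A) = (\<lambda>x. sum a I + sum c I *\<^sub>R x) ` A"
  using assms
proof (induction rule: finite_ne_induct)
  case (insert i I)
  then have "0 < sum c I" by (intro sum_pos) auto
  with insert show ?case by (simp add: set_plus_homothets)
qed simp

lemma ennreal_root_emeasure_homothet:
  fixes A :: "'a::euclidean_space set"
  assumes "0 \<le> c"
  shows "ennreal_root DIM('a) (emeasure lebesgue ((\<lambda>x. a + c *\<^sub>R x) ` A))
    = ennreal c * ennreal_root DIM('a) (emeasure lebesgue A)"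
proof -
  have "emeasure lebesgue ((\<lambda>x. c *\<^sub>R x + a) ` A) = ennreal c ^ DIM('a) * emeasure lebesgue A"
    using assms by (simp only: emeasure_lebesgue_affine abs_of_nonneg ennreal_power)
  then show ?thesis
    using assms by (simp add: add.commute ennreal_root_power_mult)
qed

lemma fractional_superadditivity:
  fixes K :: "'i \<Rightarrow> 'a::euclidean_space set" and \<beta> :: "'i set \<Rightarrow> real"
  assumes I: "finite I" "G \<subseteq> Pow I" and cv: "\<And>i. i \<in> I \<Longrightarrow> convex (K i)" and ne: "\<And>i. i \<in> I \<Longrightarrow> K i \<noteq> {}"
    and nonneg: "\<And>s. s \<in> G \<Longrightarrow> 0 \<le> \<beta> s"
    and one: "\<And>i. i \<in> I \<Longrightarrow> (\<Sum>s\<in>{s\<in>G. i \<in> s}. \<beta> s) = 1"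
  shows "(\<Sum>s\<in>G. ennreal (\<beta> s) * ennreal_root DIM('a) (emeasure lebesgue (\<Sum>j\<in>s. K j)))
    \<le> ennreal_root DIM('a) (emeasure lebesgue (\<Sum>j\<in>I. K j))"
proof -
  have finG: "finite G" using I by (meson finite_Pow_iff finite_subset)
  have cvs: "convex (\<Sum>j\<in>s. K j)" if "s \<in> G" for s
    using that I(2) cv by (intro convex_set_sum) blast
  have nes: "(\<Sum>j\<in>s. K j) \<noteq> {}" if "s \<in> G" for s
  proof -
    have "finite s" using that I by (meson PowD finite_subset subsetD)
    moreover have "\<forall>j\<in>s. \<exists>x. x \<in> K j" using ne that I(2) by blast
    then obtain f where "\<forall>j\<in>s. f j \<in> K j" by metis
    ultimately show ?thesis unfolding set_sum_alt[OF \<open>finite s\<close>] by blast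
  qed
  \<comment> \<open>The weight moves inside the root as a dilation. This includes
    \<open>\<beta> s = 0\<close>: the dilate is then a single null point, in agreement with
    \<open>0 * \<infinity> = 0\<close>.\<close>
  have "(\<Sum>s\<in>G. ennreal (\<beta> s) * ennreal_root DIM('a) (emeasure lebesgue (\<Sum>j\<in>s. K j)))
    = (\<Sum>s\<in>G. ennreal_root DIM('a) (emeasure lebesgue ((\<lambda>x. 0 + \<beta> s *\<^sub>R x) ` (\<Sum>j\<in>s. K j))))"
    by (intro sum.cong refl) (simp only: ennreal_root_emeasure_homothet nonneg)
  also have "\<dots> \<le> ennreal_root DIM('a) (emeasure lebesgue (\<Sum>s\<in>G. (\<lambda>x. 0 + \<beta> s *\<^sub>R x) ` (\<Sum>j\<in>s. K j)))"
    by (rule Brunn_Minkowski_sum) (use finG cvs nes in \<open>auto intro: convex_scaling\<close>)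
  also have "\<dots> \<le> ennreal_root DIM('a) (emeasure lebesgue (\<Sum>j\<in>I. K j))"
    using fractional_Minkowski_sum_subset[OF I cv nonneg one]
    by (intro ennreal_root_mono emeasure_mono lebesgue_convex(1) convex_set_sum cv) simp_all
  finally show ?thesis .
qed

text \<open>Each partial sum is a homothet of \<open>A\<close> whose ratio is the sum of the ratios
  \<open>c j\<close>, so the root of its volume is that ratio times a common factor
  \<open>r\<close>, possibly infinite. Exchanging sums shows that the weighted ratios add up to the
  total ratio, as the weights of the sets containing \<open>j\<close> sum to 1.\<close>

lemma fractional_additivity_homothets:
  fixes K :: "'i \<Rightarrow> 'a::euclidean_space set" and \<beta> :: "'i set \<Rightarrow> real"
  assumes I: "finite I" "G \<subseteq> Pow I" and A: "convex A" and hom: "\<And>i. i \<in> I \<Longrightarrow> homothetic A (K i)"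
    and nonneg: "\<And>s. s \<in> G \<Longrightarrow> 0 \<le> \<beta> s"
    and one: "\<And>i. i \<in> I \<Longrightarrow> (\<Sum>s\<in>{s\<in>G. i \<in> s}. \<beta> s) = 1"
  shows "(\<Sum>s\<in>G. ennreal (\<beta> s) * ennreal_root DIM('a) (emeasure lebesgue (\<Sum>j\<in>s. K j)))
    = ennreal_root DIM('a) (emeasure lebesgue (\<Sum>j\<in>I. K j))"
proof -
  have finG: "finite G" using I by (meson finite_Pow_iff finite_subset)
  obtain c a where c: "\<And>i. i \<in> I \<Longrightarrow> 0 < c i" and K: "\<And>i. i \<in> I \<Longrightarrow> K i = (\<lambda>x. a i + c i *\<^sub>R x) ` A"
    using hom unfolding homothetic_def by metis
  define r where "r = ennreal_root DIM('a) (emeasure lebesgue A)"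
  have v: "ennreal_root DIM('a) (emeasure lebesgue (\<Sum>j\<in>s. K j)) = ennreal (sum c s) * r" if "s \<subseteq> I" for s
  proof (cases "s = {}")
    case False
    have "finite s" using that I(1) by (rule finite_subset)
    have "(\<Sum>j\<in>s. K j) = (\<Sum>j\<in>s. (\<lambda>x. a j + c j *\<^sub>R x) ` A)"
      using that K by (intro sum.cong) auto
    also have "\<dots> = (\<lambda>x. sum a s + sum c s *\<^sub>R x) ` A"
      using that c by (intro sum_homothets \<open>finite s\<close> False A) auto
    finally have "ennreal_root DIM('a) (emeasure lebesgue (\<Sum>j\<in>s. K j))
      = ennreal_root DIM('a) (emeasure lebesgue ((\<lambda>x. sum a s + sum c s *\<^sub>R x) ` A))" by simp
    also have "\<dots> = ennreal (sum c s) * r"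
      unfolding r_def using that c by (intro ennreal_root_emeasure_homothet sum_nonneg less_imp_le) auto
    finally show ?thesis .
  \<comment> \<open>For empty \<open>s\<close> the Minkowski sum is the null set \<open>{0}\<close>,
    and the right side is \<open>0 * r = 0\<close> even if \<open>r\<close> is infinite.\<close>
  qed (simp add: set_zero)
  have "(\<Sum>s\<in>G. \<beta> s * sum c s) = (\<Sum>s\<in>G. \<Sum>j\<in>{j\<in>I. j \<in> s}. \<beta> s * c j)"
  proof (rule sum.cong[OF refl])
    fix s assume s: "s \<in> G"
    then have "{j \<in> I. j \<in> s} = s" using I(2) by blast
    then show "\<beta> s * sum c s = (\<Sum>j\<in>{j\<in>I. j \<in> s}. \<beta> s * c j)"
      by (simp only: sum_distrib_left)
  qed
  also have "\<dots> = (\<Sum>j\<in>I. \<Sum>s\<in>{s\<in>G. j \<in> s}. \<beta> s * c j)"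
    by (rule sum.swap_restrict[OF finG I(1)])
  also have "\<dots> = sum c I"
    by (intro sum.cong refl) (simp add: one flip: sum_distrib_right)
  finally have total: "(\<Sum>s\<in>G. \<beta> s * sum c s) = sum c I" .
  have cs: "0 \<le> sum c s" if "s \<in> G" for s
    using that I(2) c by (intro sum_nonneg less_imp_le) auto
  have "(\<Sum>s\<in>G. ennreal (\<beta> s) * ennreal_root DIM('a) (emeasure lebesgue (\<Sum>j\<in>s. K j)))
     = (\<Sum>s\<in>G. ennreal (\<beta> s * sum c s) * r)"
    using I(2) by (intro sum.cong refl) (auto simp: v nonneg cs ennreal_mult mult.assoc)
  also have "\<dots> = ennreal (\<Sum>s\<in>G. \<beta> s * sum c s) * r"
    by (simp add: nonneg cs sum_ennreal flip: sum_distrib_right)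
  finally show ?thesis by (simp add: total v)
qed

theorem theorem3p7:
  fixes M :: nat and K :: "nat \<Rightarrow> (real ^ 'n) set"
    and G :: "nat set set" and \<beta> :: "nat set \<Rightarrow> real"
  assumes "M \<ge> 2"
    and "\<And>j. j \<in> {1..M} \<Longrightarrow> K j \<noteq> {}"
    and "\<And>j. j \<in> {1..M} \<Longrightarrow> convex (K j)"
    and "G \<subseteq> Pow {1..M}"
    and "fractional_partition M G \<beta>"
  shows "ennreal_root CARD('n) (emeasure lebesgue (\<Sum>j\<in>{1..M}. K j))
           \<ge> (\<Sum>s\<in>G. ennreal (\<beta> s) * ennreal_root CARD('n) (emeasure lebesgue (\<Sum>j\<in>s. K j)))
       \<and> ((\<forall>i\<in>{1..M}. \<forall>j\<in>{1..M}. homothetic (K i) (K j)) \<longrightarrow>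
            ennreal_root CARD('n) (emeasure lebesgue (\<Sum>j\<in>{1..M}. K j))
              = (\<Sum>s\<in>G. ennreal (\<beta> s) * ennreal_root CARD('n) (emeasure lebesgue (\<Sum>j\<in>s. K j))))"
proof -
  have dim: "DIM(real ^ 'n) = CARD('n)" by simp
  have \<beta>: "\<And>s. s \<in> G \<Longrightarrow> 0 \<le> \<beta> s" "\<And>i. i \<in> {1..M} \<Longrightarrow> (\<Sum>s\<in>{s\<in>G. i \<in> s}. \<beta> s) = 1"
    using assms(5) unfolding fractional_partition_def by blast+
  show ?thesis
  proof (intro conjI impI)
    show "(\<Sum>s\<in>G. ennreal (\<beta> s) * ennreal_root CARD('n) (emeasure lebesgue (\<Sum>j\<in>s. K j)))
        \<le> ennreal_root CARD('n) (emeasure lebesgue (\<Sum>j\<in>{1..M}. K j))"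
      using fractional_superadditivity[where K = K, OF _ assms(4,3,2) \<beta>] unfolding dim by blast
  next
    assume hom: "\<forall>i\<in>{1..M}. \<forall>j\<in>{1..M}. homothetic (K i) (K j)"
    \<comment> \<open>\<open>K 1\<close> serves as the common reference shape of which all
      \<open>K i\<close> are homothets.\<close>
    have 1: "1 \<in> {1..M}" using assms(1) by simp
    have "homothetic (K 1) (K i)" if "i \<in> {1..M}" for i using hom 1 that by blast
    from fractional_additivity_homothets[where K = K, OF _ assms(4) assms(3)[OF 1] this \<beta>]
    show "ennreal_root CARD('n) (emeasure lebesgue (\<Sum>j\<in>{1..M}. K j))
        = (\<Sum>s\<in>G. ennreal (\<beta> s) * ennreal_root CARD('n) (emeasure lebesgue (\<Sum>j\<in>s. K j)))"
      unfolding dim by simp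
  qed
qed

end
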